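(* For all integers $\ell\geq1$ and $a,q,s\geq0$, whenever $s\geq a-1$, $$R_{\ell,a}(q+1,s+1)=R_{\ell,a}(q,s).$$
   Context: $\mathbb N=\{0,1,2,\ldots\}$. A state is a pair $((p,q),L)$ with control $(p,q)\in\mathbb N^2$ and stack $L=(\ell_1,\ldots,\ell_r)$ a finite, possibly empty, list of positive integers. $\mathrm{nz}$ of a list deletes its zero entries. The transitions from $((p,q),L)$ are the following; differently indexed transitions are distinct even when their targets coincide. - Early-band moves: for each $0\le h<p$, target $((h,q+p-1-h),L)$. - Last-band moves: for each $0\le h<q$, target $((p,h),\mathrm{nz}(\ell_1+q-1-h,\ell_2,\ldots,\ell_r))$, where for an empty stack $\ell_1$ is read as $0$ and the tail as empty. - Active-head moves: if $L$ is nonempty, for each $i,j\ge0$ with $i+j=\ell_1-1$, target $((p,q),\mathrm{nz}(i,j,\ell_2,\ldots,\ell_r))$. For $\ell\ge1$ and a list $L$ of positive integers, a path (finite sequence of consecutive transitions) starting at the state with control $(p,q)$ and stack $(\ell)L$ (the concatenation) is stopped if it ends at a state whose stack is exactly $L$ and no earlier state on it has stack exactly $L$. $K_\ell((p,q),(c,s))$ is the number of stopped paths from $((p,q),(\ell)L)$ to $((c,s),L)$; this number does not depend on $L$. Put $R_{\ell,a}(q,s):=K_\ell((a,q),(0,s))$. *)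

theory Defs
  imports Main
begin

type_synonym control = "nat \<times> nat"
type_synonym state = "control \<times> nat list"

text \<open>Transitions carry their index as a label, so that differently indexed transitions with the
  same target remain distinct.\<close>

datatype move = EarlyBand nat | LastBand nat | ActiveHead nat nat

definition nz :: "nat list \<Rightarrow> nat list" where
  "nz L = filter (\<lambda>x. x \<noteq> 0) L"

fun add_head :: "nat \<Rightarrow> nat list \<Rightarrow> nat list" where
  "add_head n [] = [n]"
| "add_head n (l # L) = (l + n) # L"

text \<open>No truncation occurs in the natural-number subtractions, because of the bounds on \<open>h\<close>;
  the condition \<open>i + j = l - 1\<close> is written additively. Stacks of states are lists of positive
  integers; this is required of the initial stack and preserved by every transition.\<close>

inductive step :: "state \<Rightarrow> move \<Rightarrow> state \<Rightarrow> bool" where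
  early_band: "h < p \<Longrightarrow> step ((p, q), L) (EarlyBand h) ((h, q + p - 1 - h), L)"
| last_band: "h < q \<Longrightarrow> step ((p, q), L) (LastBand h) ((p, h), nz (add_head (q - 1 - h) L))"
| active_head: "i + j + 1 = l \<Longrightarrow> step ((p, q), l # L) (ActiveHead i j) ((p, q), nz (i # j # L))"

text \<open>A path starting at \<open>x\<close> is given by the list of its transitions, each recorded as its label
  together with its target.\<close>

fun is_path :: "state \<Rightarrow> (move \<times> state) list \<Rightarrow> bool" where
  "is_path x [] \<longleftrightarrow> True"
| "is_path x ((m, y) # ts) \<longleftrightarrow> step x m y \<and> is_path y ts"

definition path_states :: "state \<Rightarrow> (move \<times> state) list \<Rightarrow> state list" where
  "path_states x ts = x # map snd ts"

definition stopped :: "nat list \<Rightarrow> state \<Rightarrow> (move \<times> state) list \<Rightarrow> bool" where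
  "stopped L x ts \<longleftrightarrow> is_path x ts \<and> snd (last (path_states x ts)) = L \<and>
     (\<forall>y \<in> set (butlast (path_states x ts)). snd y \<noteq> L)"

definition stopped_paths ::
    "nat list \<Rightarrow> nat \<Rightarrow> control \<Rightarrow> control \<Rightarrow> (move \<times> state) list set" where
  "stopped_paths L l u v =
     {ts. stopped L (u, l # L) ts \<and> last (path_states (u, l # L) ts) = (v, L)}"

text \<open>The number of stopped paths does not depend on \<open>L\<close> (\<open>card_stopped_paths\<close> below), so it is
  defined with the empty list; the set counted is finite (\<open>finite_stopped_paths\<close> below).\<close>

definition K :: "nat \<Rightarrow> control \<Rightarrow> control \<Rightarrow> nat" where
  "K l u v = card (stopped_paths [] l u v)"

definition R :: "nat \<Rightarrow> nat \<Rightarrow> nat \<Rightarrow> nat \<Rightarrow> nat" where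
  "R l a q s = K l (a, q) (0, s)"


subsection \<open>Finiteness\<close>

fun weight :: "state \<Rightarrow> nat" where
  "weight ((p, q), L) = p + q + sum_list L"

lemma sum_list_nz [simp]: "sum_list (nz L) = sum_list L"
  by (induction L) (auto simp: nz_def)

lemma sum_list_add_head [simp]: "sum_list (add_head n L) = n + sum_list L"
  by (cases L) auto

lemma step_weight: "step x m y \<Longrightarrow> weight x = Suc (weight y)"
  by (induction rule: step.induct) auto

lemma finite_steps: "finite {(m, y). step x m y}"
proof -
  obtain p q L where x: "x = ((p, q), L)"
    by (metis surj_pair)
  let ?l = "hd L"
  let ?E = "(\<lambda>h. (EarlyBand h, ((h, q + p - 1 - h), L))) ` {..<p}"
  let ?F = "(\<lambda>h. (LastBand h, ((p, h), nz (add_head (q - 1 - h) L)))) ` {..<q}"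
  let ?A = "(\<lambda>(i, j). (ActiveHead i j, ((p, q), nz (i # j # tl L)))) ` ({..<?l} \<times> {..<?l})"
  have "{(m, y). step x m y} \<subseteq> ?E \<union> ?F \<union> ?A"
    unfolding x by (auto elim!: step.cases simp: image_iff)
  then show ?thesis
    by (rule finite_subset) auto
qed

lemma finite_paths: "finite {ts. is_path x ts}"
proof (induction "weight x" arbitrary: x rule: less_induct)
  case less
  let ?S = "{(m, y). step x m y}"
  have "{ts. is_path x ts} \<subseteq> {[]} \<union> (\<Union>t \<in> ?S. (#) t ` {ts. is_path (snd t) ts})"
  proof
    fix ts assume "ts \<in> {ts. is_path x ts}"
    then show "ts \<in> {[]} \<union> (\<Union>t \<in> ?S. (#) t ` {ts. is_path (snd t) ts})"
      by (cases ts) force+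
  qed
  moreover have "finite {ts. is_path (snd t) ts}" if "t \<in> ?S" for t
    using that less step_weight[of x "fst t" "snd t"] by auto
  ultimately show ?case
    using finite_steps[of x] by (auto intro: finite_subset)
qed

lemma finite_stopped_paths: "finite (stopped_paths L l u v)"
  by (rule finite_subset[OF _ finite_paths[of "(u, l # L)"]])
    (auto simp: stopped_paths_def stopped_def)


subsection \<open>Independence of the lower part of the stack\<close>

definition lift_state :: "nat list \<Rightarrow> state \<Rightarrow> state" where
  "lift_state L x = (fst x, snd x @ L)"

definition lift_path :: "nat list \<Rightarrow> (move \<times> state) list \<Rightarrow> (move \<times> state) list" where
  "lift_path L ts = map (map_prod id (lift_state L)) ts"

lemma nz_append: "nz (M @ L) = nz M @ nz L"
  by (simp add: nz_def)

lemma nz_id: "0 \<notin> set L \<Longrightarrow> nz L = L"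
  by (induction L) (auto simp: nz_def)

lemma add_head_append: "M \<noteq> [] \<Longrightarrow> add_head n (M @ L) = add_head n M @ L"
  by (cases M) auto

lemma step_lift:
  assumes "0 \<notin> set L" and "M \<noteq> []"
  shows "step (c, M @ L) m y \<longleftrightarrow> (\<exists>z. step (c, M) m z \<and> y = lift_state L z)"
proof -
  obtain p q where c: "c = (p, q)" by (cases c)
  obtain k N where M: "M = k # N" using assms(2) by (cases M) auto
  have 1: "nz (add_head n (M @ L)) = nz (add_head n M) @ L" for n
    using assms by (simp add: add_head_append nz_append nz_id)
  have 2: "nz (i # j # N @ L) = nz (i # j # N) @ L" for i j
    using nz_append[of "i # j # N" L] nz_id[OF assms(1)] by simp
  show ?thesis
  proof
    assume "step (c, M @ L) m y"
    then show "\<exists>z. step (c, M) m z \<and> y = lift_state L z"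
    proof cases
      case (early_band h p q)
      then show ?thesis
        using step.early_band[of h p q M] by (auto simp: lift_state_def)
    next
      case (last_band h q p)
      then show ?thesis
        using step.last_band[of h q p M] 1 by (auto simp: lift_state_def)
    next
      case (active_head i j l p q L')
      then show ?thesis
        using step.active_head[of i j l p q N] 2 M by (auto simp: lift_state_def)
    qed
  next
    assume "\<exists>z. step (c, M) m z \<and> y = lift_state L z"
    then obtain z where "step (c, M) m z" and y: "y = lift_state L z" by blast
    then show "step (c, M @ L) m y"
    proof cases
      case (early_band h p q)
      then show ?thesis
        using step.early_band[of h p q "M @ L"] y by (auto simp: lift_state_def)
    next
      case (last_band h q p)
      then show ?thesis
        using step.last_band[of h q p "M @ L"] 1 y by (auto simp: lift_state_def)
    next
      case (active_head i j l p q L')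
      then show ?thesis
        using step.active_head[of i j l p q "N @ L"] 2 M y by (auto simp: lift_state_def)
    qed
  qed
qed

lemma stopped_Nil: "stopped L x [] \<longleftrightarrow> snd x = L"
  by (simp add: stopped_def path_states_def)

lemma stopped_Cons:
  "stopped L x ((m, y) # ts) \<longleftrightarrow> snd x \<noteq> L \<and> step x m y \<and> stopped L y ts"
  by (auto simp: stopped_def path_states_def)

lemma stopped_lift:
  assumes "0 \<notin> set L"
  shows "stopped L (lift_state L x) ts \<longleftrightarrow> (\<exists>ts'. stopped [] x ts' \<and> ts = lift_path L ts')"
proof (induction ts arbitrary: x)
  case Nil
  show ?case
    by (auto simp: stopped_Nil lift_state_def lift_path_def)
next
  case (Cons t ts)
  obtain m y where t: "t = (m, y)" by (cases t)
  obtain c M where x: "x = (c, M)" by (cases x)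
  show ?case (is "?lhs \<longleftrightarrow> ?rhs")
  proof
    assume ?lhs
    then have M: "M \<noteq> []" and "step (c, M @ L) m y" and st: "stopped L y ts"
      by (auto simp: t x stopped_Cons lift_state_def)
    then obtain z where z: "step (c, M) m z" "y = lift_state L z"
      using step_lift[OF assms M] by blast
    then obtain ts' where "stopped [] z ts'" "ts = lift_path L ts'"
      using st Cons.IH by blast
    then show ?rhs
      using z M by (intro exI[of _ "(m, z) # ts'"]) (auto simp: t x stopped_Cons lift_path_def)
  next
    assume ?rhs
    then obtain ts'' where "stopped [] x ts''" and "t # ts = lift_path L ts''"
      by blast
    then obtain z ts' where M: "M \<noteq> []" and z: "step (c, M) m z" "y = lift_state L z"
        and "stopped [] z ts'" "ts = lift_path L ts'"
      by (cases ts'') (auto simp: t x stopped_Cons lift_path_def)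
    then have "stopped L y ts"
      using Cons.IH by blast
    moreover have "step (c, M @ L) m y"
      using z step_lift[OF assms M] by blast
    ultimately show ?lhs
      using M by (simp add: t x stopped_Cons lift_state_def)
  qed
qed

lemma last_path_states_lift:
  "last (path_states (lift_state L x) (lift_path L ts)) = lift_state L (last (path_states x ts))"
  by (auto simp: path_states_def lift_path_def last_map)

lemma inj_lift_path: "inj (lift_path L)"
  unfolding lift_path_def
  by (intro inj_mapI prod.inj_map) (auto simp: inj_def lift_state_def prod_eq_iff)

theorem card_stopped_paths:
  assumes "0 \<notin> set L"
  shows "card (stopped_paths L l u v) = K l u v"
proof -
  have x: "(u, l # L) = lift_state L (u, [l])"
    by (simp add: lift_state_def)
  have v: "lift_state L z = (v, L) \<longleftrightarrow> z = (v, [])" for z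
    by (cases z) (auto simp: lift_state_def)
  have "stopped_paths L l u v = lift_path L ` stopped_paths [] l u v"
    unfolding stopped_paths_def x stopped_lift[OF assms]
    by (auto simp: last_path_states_lift v)
  then show ?thesis
    by (simp add: K_def card_image inj_on_subset[OF inj_lift_path])
qed

end

theory Submission
  imports Defs
begin

text \<open>
  Raising the second control coordinate \<open>q\<close> of every state by one embeds the transition system into
  itself: early-band and active-head moves keep their indices, and the last-band move to \<open>h\<close> becomes
  the one to \<open>h + 1\<close>, so that the amount \<open>q - 1 - h\<close> pushed onto the stack is the same. Stacks are
  untouched, hence stopped paths go injectively to stopped paths. The only transition out of a raised
  state that is not the image of a transition is the last-band move to \<open>0\<close>
  (\<open>step_shift_iff\<close>).

  Such a transition cannot occur on a path that ends with control \<open>(c, t + 1)\<close> when the initial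
  control \<open>(a, q + 1)\<close> satisfies \<open>a \<le> c + t + 1\<close>. It leads to a control \<open>(p, 0)\<close> with \<open>p \<le> a\<close>, and
  every transition either keeps the control or decreases its sum (\<open>path_control\<close>). From \<open>(p, 0)\<close>
  one would need \<open>c + t + 1 < p\<close>, which contradicts the bound, or \<open>(c, t + 1) = (p, 0)\<close>, which is
  absurd. So the embedding is a bijection between the two sets of stopped paths
  (\<open>stopped_paths_shift\<close>), and the theorem is the case \<open>c = 0\<close>.
\<close>

fun shift_state :: "state \<Rightarrow> state" where
  "shift_state ((p, q), L) = ((p, Suc q), L)"

fun shift_move :: "move \<Rightarrow> move" where
  "shift_move (LastBand h) = LastBand (Suc h)"
| "shift_move m = m"

definition shift_path :: "(move \<times> state) list \<Rightarrow> (move \<times> state) list" where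
  "shift_path = map (map_prod shift_move shift_state)"

lemma shift_path_simps [simp]:
  "shift_path [] = []"
  "shift_path ((m, y) # ts) = (shift_move m, shift_state y) # shift_path ts"
  by (simp_all add: shift_path_def)

lemma inj_shift_path: "inj shift_path"
proof -
  have "inj shift_state"
    by (rule injI) (auto elim!: shift_state.elims)
  moreover have "inj shift_move"
    by (rule injI) (auto elim!: shift_move.elims)
  ultimately show ?thesis
    unfolding shift_path_def by (intro inj_mapI prod.inj_map)
qed

lemma snd_shift_state [simp]: "snd (shift_state x) = snd x"
  by (cases x rule: shift_state.cases) simp

lemma step_shift:
  assumes "step x m y"
  shows "step (shift_state x) (shift_move m) (shift_state y)"
  using assms
proof cases
  case (early_band h p q L)
  moreover from this have "Suc q + p - 1 - h = Suc (q + p - 1 - h)"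
    by linarith
  ultimately show ?thesis
    using step.early_band[of h p "Suc q" L] by simp
next
  case (last_band h q p L)
  then show ?thesis
    using step.last_band[of "Suc h" "Suc q" p L] by simp
next
  case (active_head i j l p q L)
  then show ?thesis
    using step.active_head[of i j l p "Suc q" L] by simp
qed

lemma step_shift_iff:
  "step (shift_state ((p, q), L)) m y \<longleftrightarrow>
     (\<exists>m' z. step ((p, q), L) m' z \<and> m = shift_move m' \<and> y = shift_state z) \<or>
     (m = LastBand 0 \<and> y = ((p, 0), nz (add_head q L)))"
  (is "?lhs \<longleftrightarrow> ?image \<or> ?new")
proof
  assume ?lhs
  then have "step ((p, Suc q), L) m y"
    by simp
  then show "?image \<or> ?new"
  proof cases
    case (early_band h)
    moreover from this have "Suc q + p - 1 - h = Suc (q + p - 1 - h)"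
      by linarith
    ultimately show ?thesis
      using step.early_band[of h p q L]
      by (intro disjI1 exI[of _ m] exI[of _ "((h, q + p - 1 - h), L)"]) auto
  next
    case (last_band h)
    show ?thesis
    proof (cases h)
      case 0
      then show ?thesis
        using last_band by simp
    next
      case (Suc k)
      then show ?thesis
        using last_band step.last_band[of k q p L]
        by (intro disjI1 exI[of _ "LastBand k"] exI[of _ "((p, k), nz (add_head (q - 1 - k) L))"])
          auto
    qed
  next
    case (active_head i j l L')
    then show ?thesis
      using step.active_head[of i j l p q L']
      by (intro disjI1 exI[of _ m] exI[of _ "((p, q), nz (i # j # L'))"]) auto
  qed
next
  assume "?image \<or> ?new"
  then show ?lhs
    using step_shift step.last_band[of 0 "Suc q" p L] by auto
qed

abbreviation control_sum :: "state \<Rightarrow> nat" where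
  "control_sum x \<equiv> fst (fst x) + snd (fst x)"

lemma step_control:
  "step x m y \<Longrightarrow> fst y = fst x \<or> control_sum y < control_sum x"
  by (induction rule: step.induct) auto

lemma step_early_coordinate: "step x m y \<Longrightarrow> fst (fst y) \<le> fst (fst x)"
  by (induction rule: step.induct) auto

lemma path_states_Cons: "last (path_states x ((m, y) # ts)) = last (path_states y ts)"
  by (simp add: path_states_def)

text \<open>An early-band move lowers the control sum by one, a last-band move lowers it by the drop in the
  second coordinate, and an active-head move only touches the stack. Once lost, control sum is never
  recovered from the stack, so the alternative for single transitions passes to paths.\<close>

lemma path_control:
  assumes "is_path x ts"
  shows "fst (last (path_states x ts)) = fst x \<or>
         control_sum (last (path_states x ts)) < control_sum x"
  using assms
proof (induction ts arbitrary: x)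
  case Nil
  then show ?case
    by (simp add: path_states_def)
next
  case (Cons t ts)
  obtain m y where t: "t = (m, y)" by (cases t)
  with Cons.prems have "step x m y" and "is_path y ts"
    by auto
  from step_control[OF this(1)] Cons.IH[OF this(2)] show ?case
    unfolding t path_states_Cons by auto
qed

text \<open>The bound on \<open>fst (fst x)\<close> passes to all later states because that coordinate never
  increases; this is what makes the induction along the path work.\<close>

lemma stopped_shift_iff:
  assumes "fst (fst x) \<le> c + t + 1"
  shows "stopped L (shift_state x) ts \<and> last (path_states (shift_state x) ts) = ((c, Suc t), L) \<longleftrightarrow>
     (\<exists>ts'. stopped L x ts' \<and> last (path_states x ts') = ((c, t), L) \<and> ts = shift_path ts')"
  using assms
proof (induction ts arbitrary: x)
  case Nil
  have "(\<exists>ts'. stopped L x ts' \<and> last (path_states x ts') = ((c, t), L) \<and> [] = shift_path ts') \<longleftrightarrow>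
      snd x = L \<and> x = ((c, t), L)"
    by (auto simp: shift_path_def stopped_Nil path_states_def)
  then show ?case
    by (cases x rule: shift_state.cases) (auto simp: stopped_Nil path_states_def)
next
  case (Cons u ts)
  obtain m y where u: "u = (m, y)" by (cases u)
  obtain p q M where x: "x = ((p, q), M)" by (cases x rule: shift_state.cases)
  show ?case (is "?lhs \<longleftrightarrow> ?rhs")
  proof
    assume ?lhs
    then have M: "M \<noteq> L" and st: "step (shift_state x) m y" and y: "stopped L y ts"
      and end_y: "last (path_states y ts) = ((c, Suc t), L)"
      by (auto simp: u x stopped_Cons path_states_Cons)
    have "\<not> y = ((p, 0), nz (add_head q M))"
    proof
      assume "y = ((p, 0), nz (add_head q M))"
      moreover have "is_path y ts"
        using y by (simp add: stopped_def)
      ultimately show False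
        using path_control[of y ts] end_y Cons.prems by (auto simp: x)
    qed
    with st obtain m' z where z: "step x m' z" "m = shift_move m'" "y = shift_state z"
      unfolding x step_shift_iff by blast
    moreover have "fst (fst z) \<le> c + t + 1"
      using step_early_coordinate[OF z(1)] Cons.prems by simp
    ultimately obtain ts' where
      "stopped L z ts'" "last (path_states z ts') = ((c, t), L)" "ts = shift_path ts'"
      using y end_y Cons.IH by blast
    then show ?rhs
      using z M by (intro exI[of _ "(m', z) # ts'"]) (auto simp: u x stopped_Cons path_states_Cons)
  next
    assume ?rhs
    then obtain ts0 where ts0: "stopped L x ts0" "last (path_states x ts0) = ((c, t), L)"
        "u # ts = shift_path ts0"
      by blast
    then obtain m' z ts' where "ts0 = (m', z) # ts'"
      by (cases ts0) auto
    with ts0 have z: "step x m' z" "m = shift_move m'" "y = shift_state z" and M: "M \<noteq> L"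
      and ts': "stopped L z ts'" "last (path_states z ts') = ((c, t), L)" "ts = shift_path ts'"
      by (auto simp: u x stopped_Cons path_states_Cons)
    have "fst (fst z) \<le> c + t + 1"
      using step_early_coordinate[OF z(1)] Cons.prems by simp
    with ts' have "stopped L y ts \<and> last (path_states y ts) = ((c, Suc t), L)"
      using Cons.IH z(3) by blast
    then show ?lhs
      using step_shift[OF z(1)] z M by (simp add: u x stopped_Cons path_states_Cons)
  qed
qed

lemma stopped_paths_shift:
  assumes "a \<le> c + t + 1"
  shows "stopped_paths L l (a, Suc q) (c, Suc t) = shift_path ` stopped_paths L l (a, q) (c, t)"
  using stopped_shift_iff[of "((a, q), l # L)" c t L] assms
  by (auto simp: stopped_paths_def)

theorem K_shift:
  assumes "a \<le> c + t + 1"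
  shows "K l (a, Suc q) (c, Suc t) = K l (a, q) (c, t)"
  unfolding K_def stopped_paths_shift[OF assms]
  by (rule card_image) (rule inj_on_subset[OF inj_shift_path subset_UNIV])

theorem lemma7p3:
  fixes l a q s :: nat
  assumes "l \<ge> 1"
    and "int s \<ge> int a - 1"
  shows "R l a (q + 1) (s + 1) = R l a q s"
  using assms K_shift[of a 0 s l q] by (simp add: R_def)

end
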